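(* Let $q$ be a prime power, $n\ge 1$, $P=([n],\preceq)$ a poset, $w$ a weight on $\mathbb{F}_q$ and $\pi:[n]\to\mathbb{N}$, $\pi(i)=k_i$, a label map with $N=\sum_{i=1}^n k_i$. Then the map $d_{(P,w,\pi)}:\mathbb{F}_q^N\times\mathbb{F}_q^N\to\mathbb{N}\cup\{0\}$, $d_{(P,w,\pi)}(x,y)=w_{(P,w,\pi)}(x-y)$, is a metric on $\mathbb{F}_q^N$.
   Context: A weight on $\mathbb{F}_q$ is a map $w:\mathbb{F}_q\to\mathbb{N}\cup\{0\}$ with $w(\alpha)=0$ iff $\alpha=0$, $w(-\alpha)=w(\alpha)$ and $w(\alpha+\beta)\le w(\alpha)+w(\beta)$. Put $M_w=\max\{w(\alpha):\alpha\in\mathbb{F}_q\}$ and, for $v=(v_1,\dots,v_k)\in\mathbb{F}_q^k$, $\tilde w^k(v)=\max_{1\le t\le k}w(v_t)$. An ideal of $P$ is a subset $I\subseteq[n]$ such that $j\in I$ and $i\preceq j$ imply $i\in I$; $\langle A\rangle$ denotes the smallest ideal containing $A$. Write $\mathbb{F}_q^N=\mathbb{F}_q^{k_1}\oplus\cdots\oplus\mathbb{F}_q^{k_n}$, so each $x\in\mathbb{F}_q^N$ is uniquely $x=x_1\oplus\cdots\oplus x_n$ with $x_i\in\mathbb{F}_q^{k_i}$. Let $supp_\pi(x)=\{i\in[n]:x_i\neq 0\}$, $I_x=\langle supp_\pi(x)\rangle$ and $M_x$ the set of maximal elements of $I_x$. The $(P,w,\pi)$-weight is $w_{(P,w,\pi)}(x)=\sum_{i\in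 M_x}\tilde w^{k_i}(x_i)+\sum_{i\in I_x\setminus M_x}M_w$. *)

theory Defs
  imports "HOL-Analysis.Abstract_Metric_Spaces" "Jordan_Normal_Form.Matrix"
begin

definition is_weight :: "('a::field \<Rightarrow> nat) \<Rightarrow> bool" where
  "is_weight w \<longleftrightarrow>
     (\<forall>\<alpha>. w \<alpha> = 0 \<longleftrightarrow> \<alpha> = 0) \<and>
     (\<forall>\<alpha>. w (- \<alpha>) = w \<alpha>) \<and>
     (\<forall>\<alpha> \<beta>. w (\<alpha> + \<beta>) \<le> w \<alpha> + w \<beta>)"

definition weight_max :: "('a::{field,finite} \<Rightarrow> nat) \<Rightarrow> nat" where
  "weight_max w = Max (range w)"

text \<open>
  The coordinates of a vector \<open>v\<close> of type \<open>'a vec\<close> are \<open>v $ 0, \<dots>, v $ (dim_vec v - 1)\<close>.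
  The maximum is meaningful only for \<open>dim_vec v > 0\<close>.
\<close>

definition weight_vec :: "('a::field \<Rightarrow> nat) \<Rightarrow> 'a vec \<Rightarrow> nat" where
  "weight_vec w v = Max ((\<lambda>t. w (v $ t)) ` {..<dim_vec v})"

text \<open>
  The poset \<open>([n], \<preceq>)\<close> is the set \<open>{1..n}\<close> with a relation \<open>P\<close> such that
  \<open>partial_order_on {1..n} P\<close>; here \<open>(i, j) \<in> P\<close> means \<open>i \<preceq> j\<close>.
\<close>

definition is_ideal :: "nat \<Rightarrow> nat rel \<Rightarrow> nat set \<Rightarrow> bool" where
  "is_ideal n P I \<longleftrightarrow> I \<subseteq> {1..n} \<and> (\<forall>i j. j \<in> I \<and> (i, j) \<in> P \<longrightarrow> i \<in> I)"

definition maximal_elements :: "nat rel \<Rightarrow> nat set \<Rightarrow> nat set" where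
  "maximal_elements P I = {i \<in> I. \<forall>j\<in>I. (i, j) \<in> P \<longrightarrow> j = i}"

text \<open>
  With \<open>N = \<pi> 1 + \<dots> + \<pi> n\<close>, the component in the \<open>i\<close>-th summand of a vector in
  \<open>carrier_vec N\<close> consists of the \<open>\<pi> i\<close> consecutive coordinates that follow the first
  \<open>\<pi> 1 + \<dots> + \<pi> (i - 1)\<close> ones.
\<close>

definition block :: "(nat \<Rightarrow> nat) \<Rightarrow> 'a vec \<Rightarrow> nat \<Rightarrow> 'a vec" where
  "block \<pi> x i = vec (\<pi> i) (\<lambda>t. x $ ((\<Sum>j = 1..<i. \<pi> j) + t))"

definition block_supp :: "nat \<Rightarrow> (nat \<Rightarrow> nat) \<Rightarrow> 'a::field vec \<Rightarrow> nat set" where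
  "block_supp n \<pi> x = {i \<in> {1..n}. block \<pi> x i \<noteq> 0\<^sub>v (\<pi> i)}"

definition ideal_of_vec ::
  "nat \<Rightarrow> nat rel \<Rightarrow> (nat \<Rightarrow> nat) \<Rightarrow> 'a::field vec \<Rightarrow> nat set" where
  "ideal_of_vec n P \<pi> x = is_ideal n P hull block_supp n \<pi> x"

definition max_of_vec ::
  "nat \<Rightarrow> nat rel \<Rightarrow> (nat \<Rightarrow> nat) \<Rightarrow> 'a::field vec \<Rightarrow> nat set" where
  "max_of_vec n P \<pi> x = maximal_elements P (ideal_of_vec n P \<pi> x)"

definition Pw\<pi>_weight ::
  "nat \<Rightarrow> nat rel \<Rightarrow> ('a::{field,finite} \<Rightarrow> nat) \<Rightarrow> (nat \<Rightarrow> nat) \<Rightarrow> 'a vec \<Rightarrow> nat" where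
  "Pw\<pi>_weight n P w \<pi> x =
     (\<Sum>i\<in>max_of_vec n P \<pi> x. weight_vec w (block \<pi> x i)) +
     (\<Sum>i\<in>ideal_of_vec n P \<pi> x - max_of_vec n P \<pi> x. weight_max w)"

text \<open>
  This distance is meant for two vectors of dimension \<open>\<pi> 1 + \<dots> + \<pi> n\<close>. The locale
  \<open>Metric_space\<close> demands symmetry on the whole type and not only on the carrier, so
  the distance has to be cut off to \<open>0\<close> outside the carrier to form an instance; all its
  values on the carrier are unaffected.
\<close>

definition Pw\<pi>_dist ::
  "nat \<Rightarrow> nat rel \<Rightarrow> ('a::{field,finite} \<Rightarrow> nat) \<Rightarrow> (nat \<Rightarrow> nat) \<Rightarrow> 'a vec \<Rightarrow> 'a vec \<Rightarrow> nat" where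
  "Pw\<pi>_dist n P w \<pi> x y = Pw\<pi>_weight n P w \<pi> (x - y)"

end

theory Submission
  imports Defs
begin

text \<open>
  The weight is a sum over \<open>{1..n}\<close> of a local contribution at each position \<open>i\<close>, and the
  triangle inequality already holds for the local contributions. The only case that is not settled
  by the bound \<open>weight_max w\<close> is the one in which \<open>i\<close> lies strictly below no element of either of
  the two ideals. As the ideal of a sum is contained in the union of the ideals, \<open>i\<close> is then also
  maximal or absent for the sum, and the triangle inequality of \<open>weight_vec\<close> applies.
\<close>

section \<open>Weights of vectors\<close>

lemma weight_le_weight_max: "w \<alpha> \<le> weight_max w"
  unfolding weight_max_def by (intro Max_ge) auto

lemma weight_le_weight_vec: "t < dim_vec v \<Longrightarrow> w (v $ t) \<le> weight_vec w v"
  unfolding weight_vec_def by (intro Max_ge) auto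

text \<open>In positive dimension the maximum ranges over a nonempty finite set, so it is bounded
  exactly when every coordinate weight is. The maximum over the empty set has no usable
  value.\<close>

lemma weight_vec_le_iff:
  assumes "dim_vec v > 0"
  shows "weight_vec w v \<le> m \<longleftrightarrow> (\<forall>t<dim_vec v. w (v $ t) \<le> m)"
  unfolding weight_vec_def using assms by (subst Max_le_iff) auto

lemma weight_vec_le_weight_max: "dim_vec v > 0 \<Longrightarrow> weight_vec w v \<le> weight_max w"
  by (simp add: weight_vec_le_iff weight_le_weight_max)

lemma weight_vec_eq_0_iff:
  assumes "is_weight w" and "v \<in> carrier_vec k" and "k > 0"
  shows "weight_vec w v = 0 \<longleftrightarrow> v = 0\<^sub>v k"
proof -
  have "weight_vec w v = 0 \<longleftrightarrow> (\<forall>t<k. v $ t = 0)"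
    \<comment> \<open>A natural number is 0 iff it is at most 0, so vanishing is the bound with
      \<open>m = 0\<close>.\<close>
    using weight_vec_le_iff[of v w 0] assms by (auto simp: is_weight_def)
  then show ?thesis
    using assms(2) by auto
qed

lemma weight_vec_add_le:
  assumes "is_weight w" and "u \<in> carrier_vec k" and "v \<in> carrier_vec k" and "k > 0"
  shows "weight_vec w (u + v) \<le> weight_vec w u + weight_vec w v"
proof -
  have "w (u $ t + v $ t) \<le> weight_vec w u + weight_vec w v" if "t < k" for t
  proof -
    have "w (u $ t + v $ t) \<le> w (u $ t) + w (v $ t)"
      using assms(1) by (simp add: is_weight_def)
    also have "\<dots> \<le> weight_vec w u + weight_vec w v"
      using assms that by (intro add_mono weight_le_weight_vec) auto
    finally show ?thesis .
  qed
  then show ?thesis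
    using assms by (subst weight_vec_le_iff) auto
qed

lemma weight_vec_uminus: "is_weight w \<Longrightarrow> weight_vec w (- v) = weight_vec w v"
  unfolding weight_vec_def is_weight_def by (intro arg_cong[where f = Max] image_cong) auto

section \<open>Blocks of a vector\<close>

lemma block_carrier [simp]: "block \<pi> x i \<in> carrier_vec (\<pi> i)"
  by (simp add: block_def)

lemma dim_block [simp]: "dim_vec (block \<pi> x i) = \<pi> i"
  by (simp add: block_def)

lemma block_index_less:
  fixes \<pi> :: "nat \<Rightarrow> nat"
  assumes "i \<in> {1..n}" and "t < \<pi> i"
  shows "(\<Sum>j = 1..<i. \<pi> j) + t < (\<Sum>j = 1..n. \<pi> j)"
proof -
  \<comment> \<open>The right-hand sum is the offset of block \<open>i\<close> plus its length, i.e.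
    the first coordinate position after the block.\<close>
  have "(\<Sum>j = 1..<i. \<pi> j) + t < (\<Sum>j\<in>insert i {1..<i}. \<pi> j)"
    using assms by simp
  also have "\<dots> \<le> (\<Sum>j = 1..n. \<pi> j)"
    using assms by (intro sum_mono2) auto
  finally show ?thesis .
qed

text \<open>The blocks leave no gap among the coordinates: an index below the total length lies
  either in the first \<open>n\<close> blocks, by induction, or in the last one. This is why a
  vector whose blocks all vanish is itself zero.\<close>

lemma block_index_exists:
  fixes \<pi> :: "nat \<Rightarrow> nat"
  assumes "k < (\<Sum>j = 1..n. \<pi> j)"
  shows "\<exists>i\<in>{1..n}. \<exists>t<\<pi> i. k = (\<Sum>j = 1..<i. \<pi> j) + t"
  using assms
proof (induction n)
  case (Suc n)
  show ?case
  proof (cases "k < (\<Sum>j = 1..n. \<pi> j)")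
    case True
    then obtain i t where "i \<in> {1..n}" "t < \<pi> i" "k = (\<Sum>j = 1..<i. \<pi> j) + t"
      using Suc.IH by blast
    then show ?thesis
      by (intro bexI[of _ i] exI[of _ t]) auto
  next
    case False
    have "{1..<Suc n} = {1..n}"
      by auto
    then show ?thesis
      using False Suc.prems
      \<comment> \<open>The offset inside the last block is what remains of \<open>k\<close> after
        the lengths of all earlier blocks.\<close>
      by (intro bexI[of _ "Suc n"] exI[of _ "k - (\<Sum>j = 1..n. \<pi> j)"]) auto
  qed
qed simp

text \<open>The dimension of \<open>x + y\<close> is that of \<open>y\<close>; the indices read by a
  block stay below it, so addition there is coordinatewise.\<close>

lemma block_add:
  assumes "i \<in> {1..n}" and "y \<in> carrier_vec (\<Sum>j = 1..n. \<pi> j)"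
  shows "block \<pi> (x + y) i = block \<pi> x i + block \<pi> y i"
  using assms block_index_less[of i n _ \<pi>] by (auto simp: block_def)

lemma block_uminus:
  assumes "i \<in> {1..n}" and "x \<in> carrier_vec (\<Sum>j = 1..n. \<pi> j)"
  shows "block \<pi> (- x) i = - block \<pi> x i"
  using assms block_index_less[of i n _ \<pi>] by (auto simp: block_def)

lemma blocks_eq_zero_iff:
  assumes "x \<in> carrier_vec (\<Sum>j = 1..n. \<pi> j)"
  shows "(\<forall>i\<in>{1..n}. block \<pi> x i = 0\<^sub>v (\<pi> i)) \<longleftrightarrow> x = 0\<^sub>v (\<Sum>j = 1..n. \<pi> j)"
proof
  assume zero: "\<forall>i\<in>{1..n}. block \<pi> x i = 0\<^sub>v (\<pi> i)"
  show "x = 0\<^sub>v (\<Sum>j = 1..n. \<pi> j)"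
  proof (rule eq_vecI)
    fix k assume "k < dim_vec (0\<^sub>v (\<Sum>j = 1..n. \<pi> j) :: 'a vec)"
    then obtain i t where it: "i \<in> {1..n}" "t < \<pi> i" "k = (\<Sum>j = 1..<i. \<pi> j) + t"
      using block_index_exists[of k \<pi> n] by auto
    have "x $ k = block \<pi> x i $ t"
      using it by (simp add: block_def)
    also have "\<dots> = 0"
      using zero it by simp
    finally show "x $ k = 0\<^sub>v (\<Sum>j = 1..n. \<pi> j) $ k"
      using block_index_less[of i n t \<pi>] it by simp
  qed (use assms in auto)
next
  assume "x = 0\<^sub>v (\<Sum>j = 1..n. \<pi> j)"
  then show "\<forall>i\<in>{1..n}. block \<pi> x i = 0\<^sub>v (\<pi> i)"
    using block_index_less[of _ n _ \<pi>] by (auto simp: block_def)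
qed

section \<open>The ideal of a vector\<close>

lemma is_ideal_ideal_of_vec:
  assumes "P \<subseteq> {1..n} \<times> {1..n}"
  shows "is_ideal n P (ideal_of_vec n P \<pi> x)"
proof -
  \<comment> \<open>The hull is an intersection over all ideals containing the support. The witness
    \<open>{1..n}\<close> makes this family nonempty, which keeps the intersection inside
    \<open>{1..n}\<close>.\<close>
  have "is_ideal n P {1..n} \<and> block_supp n \<pi> x \<subseteq> {1..n}"
    using assms by (auto simp: is_ideal_def block_supp_def)
  then show ?thesis
    unfolding ideal_of_vec_def hull_def is_ideal_def by blast
qed

lemma block_supp_subset_ideal_of_vec: "block_supp n \<pi> x \<subseteq> ideal_of_vec n P \<pi> x"
  unfolding ideal_of_vec_def by (rule hull_subset)

text \<open>A block of the sum can be nonzero only where a block of a summand is, and a union of two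
  ideals is an ideal. Minimality of the hull does the rest.\<close>

lemma ideal_of_vec_add:
  assumes "P \<subseteq> {1..n} \<times> {1..n}" and "y \<in> carrier_vec (\<Sum>j = 1..n. \<pi> j)"
  shows "ideal_of_vec n P \<pi> (x + y) \<subseteq> ideal_of_vec n P \<pi> x \<union> ideal_of_vec n P \<pi> y"
proof -
  have "block_supp n \<pi> (x + y) \<subseteq> block_supp n \<pi> x \<union> block_supp n \<pi> y"
    using assms by (auto simp: block_supp_def block_add)
  also have "\<dots> \<subseteq> ideal_of_vec n P \<pi> x \<union> ideal_of_vec n P \<pi> y"
    by (intro Un_mono block_supp_subset_ideal_of_vec)
  finally show ?thesis
    unfolding ideal_of_vec_def[of n P \<pi> "x + y"]
    using is_ideal_ideal_of_vec[OF assms(1), of \<pi> x] is_ideal_ideal_of_vec[OF assms(1), of \<pi> y]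
    by (intro hull_minimal) (auto simp: is_ideal_def)
qed

lemma block_supp_uminus:
  fixes x :: "'a::field vec"
  assumes "x \<in> carrier_vec (\<Sum>j = 1..n. \<pi> j)"
  shows "block_supp n \<pi> (- x) = block_supp n \<pi> x"
  using assms by (auto simp: block_supp_def block_uminus uminus_zero_vec_eq)

lemma ideal_of_vec_uminus:
  assumes "x \<in> carrier_vec (\<Sum>j = 1..n. \<pi> j)"
  shows "ideal_of_vec n P \<pi> (- x) = ideal_of_vec n P \<pi> x"
  using assms by (simp add: ideal_of_vec_def block_supp_uminus)

lemma max_of_vec_subset: "max_of_vec n P \<pi> x \<subseteq> ideal_of_vec n P \<pi> x"
  by (auto simp: max_of_vec_def maximal_elements_def)

section \<open>Local contributions to the weight\<close>

definition local_weight ::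
  "nat \<Rightarrow> nat rel \<Rightarrow> ('a::{field,finite} \<Rightarrow> nat) \<Rightarrow> (nat \<Rightarrow> nat) \<Rightarrow> 'a vec \<Rightarrow> nat \<Rightarrow> nat" where
  "local_weight n P w \<pi> x i =
     (if i \<in> max_of_vec n P \<pi> x then weight_vec w (block \<pi> x i)
      else if i \<in> ideal_of_vec n P \<pi> x then weight_max w else 0)"

lemma Pw\<pi>_weight_eq_sum:
  assumes "P \<subseteq> {1..n} \<times> {1..n}"
  shows "Pw\<pi>_weight n P w \<pi> x = (\<Sum>i = 1..n. local_weight n P w \<pi> x i)"
proof -
  let ?I = "ideal_of_vec n P \<pi> x" and ?M = "max_of_vec n P \<pi> x"
  have I: "?I \<subseteq> {1..n}"
    using is_ideal_ideal_of_vec[OF assms] by (auto simp: is_ideal_def)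
  then have "finite ?I"
    by (rule finite_subset) simp
  have "(\<Sum>i = 1..n. local_weight n P w \<pi> x i) = (\<Sum>i\<in>?I. local_weight n P w \<pi> x i)"
    using I max_of_vec_subset[of n P \<pi> x]
    by (intro sum.mono_neutral_right) (auto simp: local_weight_def)
  also have "\<dots> = (\<Sum>i\<in>?I - ?M. local_weight n P w \<pi> x i) + (\<Sum>i\<in>?M. local_weight n P w \<pi> x i)"
    by (rule sum.subset_diff[OF max_of_vec_subset \<open>finite ?I\<close>])
  also have "(\<Sum>i\<in>?I - ?M. local_weight n P w \<pi> x i) = (\<Sum>i\<in>?I - ?M. weight_max w)"
    by (intro sum.cong) (auto simp: local_weight_def)
  also have "(\<Sum>i\<in>?M. local_weight n P w \<pi> x i) = (\<Sum>i\<in>?M. weight_vec w (block \<pi> x i))"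
    by (intro sum.cong) (auto simp: local_weight_def)
  finally show ?thesis
    by (simp add: Pw\<pi>_weight_def)
qed

lemma local_weight_le_weight_max: "\<pi> i > 0 \<Longrightarrow> local_weight n P w \<pi> x i \<le> weight_max w"
  by (simp add: local_weight_def weight_vec_le_weight_max)

text \<open>At a maximal element there is equality, at other elements of the ideal
  \<open>weight_max w\<close> dominates, and outside the ideal the block is zero. This lower bound
  serves both the triangle inequality and definiteness.\<close>

lemma weight_vec_block_le_local_weight:
  assumes "is_weight w" and "i \<in> {1..n}" and "\<pi> i > 0"
  shows "weight_vec w (block \<pi> x i) \<le> local_weight n P w \<pi> x i"
proof (cases "i \<in> ideal_of_vec n P \<pi> x")
  case True
  then show ?thesis
    using assms by (simp add: local_weight_def weight_vec_le_weight_max)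
next
  case False
  then have "block \<pi> x i = 0\<^sub>v (\<pi> i)"
    using assms block_supp_subset_ideal_of_vec[of n \<pi> x P] by (auto simp: block_supp_def)
  then show ?thesis
    using assms weight_vec_eq_0_iff[OF assms(1), of "block \<pi> x i" "\<pi> i"] by simp
qed

lemma local_weight_add_le:
  assumes "P \<subseteq> {1..n} \<times> {1..n}" and "is_weight w" and "i \<in> {1..n}" and "\<pi> i > 0"
    and "y \<in> carrier_vec (\<Sum>j = 1..n. \<pi> j)"
  shows "local_weight n P w \<pi> (x + y) i \<le> local_weight n P w \<pi> x i + local_weight n P w \<pi> y i"
proof -
  let ?I = "ideal_of_vec n P \<pi>" and ?M = "max_of_vec n P \<pi>"
  have I: "?I (x + y) \<subseteq> ?I x \<union> ?I y"
    using assms by (intro ideal_of_vec_add)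
  consider (absent) "i \<notin> ?I (x + y)" | (left) "i \<in> ?I x - ?M x" | (right) "i \<in> ?I y - ?M y"
    | (top) "i \<in> ?I (x + y)" "i \<notin> ?I x - ?M x" "i \<notin> ?I y - ?M y"
    by blast
  then show ?thesis
  proof cases
    case absent
    then show ?thesis
      using max_of_vec_subset[of n P \<pi> "x + y"] by (auto simp: local_weight_def)
  next
    \<comment> \<open>The contribution of \<open>x\<close> alone is already
      \<open>weight_max w\<close>, which bounds the contribution of the sum.\<close>
    case left
    then show ?thesis
      using local_weight_le_weight_max[of \<pi> i n P w "x + y"] assms by (simp add: local_weight_def)
  next
    case right
    then show ?thesis
      using local_weight_le_weight_max[of \<pi> i n P w "x + y"] assms by (simp add: local_weight_def)
  next
    case top
    \<comment> \<open>An element \<open>j\<close> of the ideal above \<open>i\<close> forces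
      \<open>i\<close> into the ideal by downward closure; since \<open>i\<close> is not a
      non-maximal element, it is maximal there, whence \<open>j = i\<close>.\<close>
    have no_larger: "j = i" if "(i, j) \<in> P" "j \<in> ?I z" "i \<notin> ?I z - ?M z" for j and z :: "'a vec"
    proof -
      have "i \<in> ?I z"
        using is_ideal_ideal_of_vec[OF assms(1), of \<pi> z] that by (auto simp: is_ideal_def)
      then show ?thesis
        using that by (auto simp: max_of_vec_def maximal_elements_def)
    qed
    have "i \<in> ?M (x + y)"
      unfolding max_of_vec_def maximal_elements_def using top I no_larger by blast
    then have "local_weight n P w \<pi> (x + y) i = weight_vec w (block \<pi> x i + block \<pi> y i)"
      using block_add[OF assms(3,5)] by (simp add: local_weight_def)
    also have "\<dots> \<le> weight_vec w (block \<pi> x i) + weight_vec w (block \<pi> y i)"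
      using assms by (intro weight_vec_add_le) auto
    \<comment> \<open>Here \<open>i\<close> may be missing from one of the two ideals; the block
      there is then zero and the bound still holds.\<close>
    also have "\<dots> \<le> local_weight n P w \<pi> x i + local_weight n P w \<pi> y i"
      using assms by (intro add_mono weight_vec_block_le_local_weight)
    finally show ?thesis .
  qed
qed

lemma local_weight_uminus:
  assumes "is_weight w" and "i \<in> {1..n}" and "x \<in> carrier_vec (\<Sum>j = 1..n. \<pi> j)"
  shows "local_weight n P w \<pi> (- x) i = local_weight n P w \<pi> x i"
  using assms
  by (simp add: local_weight_def max_of_vec_def ideal_of_vec_uminus weight_vec_uminus
      block_uminus[OF assms(2,3)])

section \<open>The weight and its metric\<close>

lemma Pw\<pi>_weight_add_le:
  assumes "P \<subseteq> {1..n} \<times> {1..n}" and "is_weight w" and "\<And>i. i \<in> {1..n} \<Longrightarrow> \<pi> i > 0"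
    and "y \<in> carrier_vec (\<Sum>j = 1..n. \<pi> j)"
  shows "Pw\<pi>_weight n P w \<pi> (x + y) \<le> Pw\<pi>_weight n P w \<pi> x + Pw\<pi>_weight n P w \<pi> y"
  unfolding Pw\<pi>_weight_eq_sum[OF assms(1)] sum.distrib[symmetric]
  using assms by (intro sum_mono local_weight_add_le)

lemma Pw\<pi>_weight_uminus:
  assumes "P \<subseteq> {1..n} \<times> {1..n}" and "is_weight w" and "x \<in> carrier_vec (\<Sum>j = 1..n. \<pi> j)"
  shows "Pw\<pi>_weight n P w \<pi> (- x) = Pw\<pi>_weight n P w \<pi> x"
  unfolding Pw\<pi>_weight_eq_sum[OF assms(1)]
  using assms by (intro sum.cong refl local_weight_uminus)

lemma Pw\<pi>_weight_eq_0_iff: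
  assumes "P \<subseteq> {1..n} \<times> {1..n}" and "is_weight w" and "\<And>i. i \<in> {1..n} \<Longrightarrow> \<pi> i > 0"
    and "x \<in> carrier_vec (\<Sum>j = 1..n. \<pi> j)"
  shows "Pw\<pi>_weight n P w \<pi> x = 0 \<longleftrightarrow> x = 0\<^sub>v (\<Sum>j = 1..n. \<pi> j)"
proof
  assume "Pw\<pi>_weight n P w \<pi> x = 0"
  then have "local_weight n P w \<pi> x i = 0" if "i \<in> {1..n}" for i
    using that by (simp add: Pw\<pi>_weight_eq_sum[OF assms(1)])
  \<comment> \<open>Each block weight is squeezed below a vanishing local contribution, so all
    blocks vanish at once, without looking for a maximal element.\<close>
  then have "weight_vec w (block \<pi> x i) = 0" if "i \<in> {1..n}" for i
    using that weight_vec_block_le_local_weight[of w i n \<pi> x P] assms by simp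
  then have "\<forall>i\<in>{1..n}. block \<pi> x i = 0\<^sub>v (\<pi> i)"
    using weight_vec_eq_0_iff[OF assms(2) block_carrier] assms(3) by blast
  then show "x = 0\<^sub>v (\<Sum>j = 1..n. \<pi> j)"
    using blocks_eq_zero_iff[OF assms(4)] by blast
next
  assume "x = 0\<^sub>v (\<Sum>j = 1..n. \<pi> j)"
  then have "block_supp n \<pi> x = {}"
    using blocks_eq_zero_iff[OF assms(4)] by (auto simp: block_supp_def)
  moreover have "is_ideal n P {}"
    by (simp add: is_ideal_def)
  ultimately have "ideal_of_vec n P \<pi> x = {}"
    by (simp add: ideal_of_vec_def hull_same)
  then show "Pw\<pi>_weight n P w \<pi> x = 0"
    by (simp add: Pw\<pi>_weight_def max_of_vec_def maximal_elements_def)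
qed

theorem theorem2p1:
  fixes n N :: nat
    and P :: "nat rel"
    and w :: "'a::{field,finite} \<Rightarrow> nat"
    and \<pi> :: "nat \<Rightarrow> nat"
  assumes "n \<ge> 1"
    and "partial_order_on {1..n} P"
    and "is_weight w"
    and "\<And>i. i \<in> {1..n} \<Longrightarrow> \<pi> i > 0"
    and "N = (\<Sum>i = 1..n. \<pi> i)"
  shows "Metric_space (carrier_vec N :: 'a vec set)
           (\<lambda>x y. if x \<in> carrier_vec N \<and> y \<in> carrier_vec N
                  then real (Pw\<pi>_dist n P w \<pi> x y) else 0)"
proof -
  have P: "P \<subseteq> {1..n} \<times> {1..n}"
    using assms(2) by (auto simp: partial_order_on_def preorder_on_def)
  have commute: "Pw\<pi>_dist n P w \<pi> x y = Pw\<pi>_dist n P w \<pi> y x"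
    if "x \<in> carrier_vec N" "y \<in> carrier_vec N" for x y
  proof -
    have "x - y = - (y - x)"
      using that by auto
    then show ?thesis
      using that assms(5) Pw\<pi>_weight_uminus[OF P assms(3), where x = "y - x"]
      by (simp add: Pw\<pi>_dist_def)
  qed
  have zero: "Pw\<pi>_dist n P w \<pi> x y = 0 \<longleftrightarrow> x = y"
    if "x \<in> carrier_vec N" "y \<in> carrier_vec N" for x y
  proof -
    have "x - y = 0\<^sub>v N \<longleftrightarrow> x = y"
      using that by (auto simp: vec_eq_iff)
    then show ?thesis
      using that assms(5) Pw\<pi>_weight_eq_0_iff[OF P assms(3,4), where x = "x - y"]
      by (simp add: Pw\<pi>_dist_def)
  qed
  have triangle: "Pw\<pi>_dist n P w \<pi> x z \<le> Pw\<pi>_dist n P w \<pi> x y + Pw\<pi>_dist n P w \<pi> y z"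
    if "x \<in> carrier_vec N" "y \<in> carrier_vec N" "z \<in> carrier_vec N" for x y z
  proof -
    have "x - z = (x - y) + (y - z)"
      using that by auto
    then show ?thesis
      using that assms(5) Pw\<pi>_weight_add_le[OF P assms(3,4), where x = "x - y" and y = "y - z"]
      by (simp add: Pw\<pi>_dist_def)
  qed
  show ?thesis
    \<comment> \<open>Folding a sum of casts into the cast of a sum reduces the real triangle
      inequality to the one over the naturals.\<close>
    by unfold_locales (use commute zero triangle in \<open>auto simp flip: of_nat_add\<close>)
qed

end
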